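(* Let $S=\bigoplus_{n\ge 1}S_n$ be a graded associative algebra over a field $\mathbb{K}$. Then the set $\mathcal{J}^g(S)=1+\hat S$ with the product $\circ$ is a loop with unit element $1$.
   Context: The field $\mathbb{K}$ has characteristic zero. Algebras are not assumed commutative. $\hat S=\prod_{n\ge 1}S_n$ is the completion of $S$ with respect to the grading, whose elements are written as formal sums $\sum_{n\ge1}\alpha_n$ with $\alpha_n\in S_n$. $\mathcal{J}^g(S):=1+\hat S$, where $1$ is a formal unit element; its elements are written $\sum_{n\ge 0}\alpha_n$ with $\alpha_0=1$ and $\alpha_n\in S_n$ for $n\ge 1$. The product $\circ$ is $$\Big(\sum_{m\ge 0}\alpha_m\Big)\circ\Big(\sum_{n\ge 0}\beta_n\Big):=\sum_{m\ge 0}\alpha_m\Big(\sum_{n\ge 0}\beta_n\Big)^{m+1},$$ where the right-hand side is computed in the associative unital algebra obtained by adjoining $1$ to $\hat S$. A loop $(Q,xy,e)$ is a set $Q$ with a binary product $xy$ and an element $e\in Q$ such that $ex=x=xe$ for all $x\in Q$ and such that, for every $x\in Q$, the maps $y\mapsto xy$ and $y\mapsto yx$ are bijections of $Q$. *)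

theory Defs
  imports Complex_Main "HOL-Library.Groups_Big_Fun"
begin

text \<open>
  Only the pieces \<open>S n\<close> with \<open>n \<ge> 1\<close> matter; \<open>S 0\<close> is ignored throughout. An element of
  \<open>\<Prod>n\<ge>1. S n\<close> is a sequence whose entry at index \<open>0\<close> is set to \<open>0\<close>.
  The class \<open>ring\<close> demands neither a unit nor commutativity.
\<close>

definition completion :: "(nat \<Rightarrow> 'a::zero set) \<Rightarrow> (nat \<Rightarrow> 'a) set" where
  "completion S = {f. f 0 = 0 \<and> (\<forall>n\<ge>1. f n \<in> S n)}"

locale graded_algebra = vector_space scale
  for scale :: "'k::field_char_0 \<Rightarrow> 'a::ring \<Rightarrow> 'a" +
  fixes S :: "nat \<Rightarrow> 'a set"
  assumes scale_mult_left: "scale c x * y = scale c (x * y)"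
    and scale_mult_right: "x * scale c y = scale c (x * y)"
    and subspace_piece: "n \<ge> 1 \<Longrightarrow> subspace (S n)"
    and direct_sum: "\<exists>!f. f \<in> completion S \<and> finite {n. f n \<noteq> 0} \<and> x = Sum_any f"
    and mult_piece: "m \<ge> 1 \<Longrightarrow> n \<ge> 1 \<Longrightarrow> x \<in> S m \<Longrightarrow> y \<in> S n \<Longrightarrow> x * y \<in> S (m + n)"

definition completion_mult :: "(nat \<Rightarrow> 'a::ring) \<Rightarrow> (nat \<Rightarrow> 'a) \<Rightarrow> nat \<Rightarrow> 'a" where
  "completion_mult f g = (\<lambda>n. \<Sum>i=1..<n. f i * g (n - i))"

text \<open>
  The algebra obtained by adjoining a unit to the completion: the pair \<open>(c, f)\<close> stands for
  \<open>c \<cdot> 1 + f\<close>.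
\<close>

type_synonym ('k, 'a) adjoined = "'k \<times> (nat \<Rightarrow> 'a)"

definition adj_one :: "('k::field, 'a::ring) adjoined" where
  "adj_one = (1, \<lambda>_. 0)"

definition adj_mult ::
  "('k::field \<Rightarrow> 'a::ring \<Rightarrow> 'a) \<Rightarrow> ('k, 'a) adjoined \<Rightarrow> ('k, 'a) adjoined \<Rightarrow> ('k, 'a) adjoined"
where
  "adj_mult scale x y =
     (fst x * fst y,
      \<lambda>n. scale (fst x) (snd y n) + scale (fst y) (snd x n) + completion_mult (snd x) (snd y) n)"

primrec adj_power ::
  "('k::field \<Rightarrow> 'a::ring \<Rightarrow> 'a) \<Rightarrow> ('k, 'a) adjoined \<Rightarrow> nat \<Rightarrow> ('k, 'a) adjoined"
where
  "adj_power scale x 0 = adj_one"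
| "adj_power scale x (Suc k) = adj_mult scale x (adj_power scale x k)"

definition adj_component :: "('k::field, 'a::ring) adjoined \<Rightarrow> nat \<Rightarrow> ('k, 'a) adjoined" where
  "adj_component x m =
     (if m = 0 then (fst x, \<lambda>_. 0) else (0, \<lambda>n. if n = m then snd x m else 0))"

text \<open>
  Infinite sums are formed degree by degree. \<open>Sum_any\<close> is the intended value only for finitely many
  nonzero summands; lemma \<open>circ_summand_eq_0\<close> below shows that this holds in the definition of
  the product \<open>circ\<close>.
\<close>

definition adj_sum :: "(nat \<Rightarrow> ('k::field, 'a::ring) adjoined) \<Rightarrow> ('k, 'a) adjoined" where
  "adj_sum F = (Sum_any (\<lambda>m. fst (F m)), \<lambda>n. Sum_any (\<lambda>m. snd (F m) n))"

definition Jg :: "(nat \<Rightarrow> 'a::ring set) \<Rightarrow> ('k::field, 'a) adjoined set" where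
  "Jg S = {1} \<times> completion S"

definition circ ::
  "('k::field \<Rightarrow> 'a::ring \<Rightarrow> 'a) \<Rightarrow> ('k, 'a) adjoined \<Rightarrow> ('k, 'a) adjoined \<Rightarrow> ('k, 'a) adjoined"
where
  "circ scale a b = adj_sum (\<lambda>m. adj_mult scale (adj_component a m) (adj_power scale b (m + 1)))"

lemma (in graded_algebra) circ_summand_eq_0:
  fixes a b :: "('k, 'a) adjoined"
  defines "F \<equiv> \<lambda>m. adj_mult scale (adj_component a m) (adj_power scale b (m + 1))"
  shows "m > 0 \<Longrightarrow> fst (F m) = 0" and "m > n \<Longrightarrow> snd (F m) n = 0"
  by (auto simp: F_def adj_mult_def adj_component_def completion_mult_def intro!: sum.neutral)

definition is_loop :: "'q set \<Rightarrow> ('q \<Rightarrow> 'q \<Rightarrow> 'q) \<Rightarrow> 'q \<Rightarrow> bool" where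
  "is_loop Q p e \<longleftrightarrow>
     (\<forall>x\<in>Q. \<forall>y\<in>Q. p x y \<in> Q) \<and> e \<in> Q \<and> (\<forall>x\<in>Q. p e x = x \<and> p x e = x) \<and>
     (\<forall>x\<in>Q. bij_betw (\<lambda>y. p x y) Q Q \<and> bij_betw (\<lambda>y. p y x) Q Q)"

end

theory Submission
  imports Defs
begin

text \<open>
  The product \<open>\<circ>\<close> is triangular with respect to the grading. Let \<open>n \<ge> 1\<close>. The term
  \<open>\<alpha>\<^sub>m (1 + \<beta>\<^sub>1 + \<beta>\<^sub>2 + \<dots>)\<^bsup>m+1\<^esup>\<close> contributes \<open>\<beta>\<^sub>n\<close> in degree \<open>n\<close>
  for \<open>m = 0\<close> and \<open>\<alpha>\<^sub>n\<close> for \<open>m = n\<close>; for \<open>0 < m < n\<close> it contributes \<open>\<alpha>\<^sub>m\<close> times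
  the part of degree \<open>n - m\<close> of the power, and terms with \<open>m > n\<close> do not reach degree \<open>n\<close>
  (lemma \<open>circ_eq\<close>). Hence \<open>(\<alpha> \<circ> \<beta>)\<^sub>n = \<alpha>\<^sub>n + \<beta>\<^sub>n + R\<^sub>n\<close>, where \<open>R\<^sub>n\<close> involves only
  \<open>\<alpha>\<^sub>i\<close> and \<open>\<beta>\<^sub>i\<close> with \<open>0 < i < n\<close>.

  An equation \<open>\<alpha> \<circ> \<beta> = \<gamma>\<close> with one of the factors unknown can therefore be solved degree by
  degree, in exactly one way. This argument is isolated in lemma
  \<open>bij_betw_id_plus_strictly_causal\<close>, which applies to both translations. The unit laws follow
  from the same degreewise formula: for \<open>\<alpha> = 1\<close> and for \<open>\<beta> = 1\<close> every remainder vanishes.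
\<close>

section \<open>Solving triangular equations degree by degree\<close>

text \<open>
  The truncation below \<open>n\<close> lets the recursion consult only the entries found so far, even though
  the operator \<open>T\<close> takes a whole sequence as its argument.
\<close>

fun triangular_solution :: "((nat \<Rightarrow> 'a::ab_group_add) \<Rightarrow> nat \<Rightarrow> 'a) \<Rightarrow> (nat \<Rightarrow> 'a) \<Rightarrow> nat \<Rightarrow> 'a"
where
  "triangular_solution T y n = y n - T (\<lambda>i. if i < n then triangular_solution T y i else 0) n"

declare triangular_solution.simps [simp del]

context graded_algebra
begin

lemma zero_in_completion: "(\<lambda>_. 0) \<in> completion S"
  by (auto simp: completion_def subspace_0 subspace_piece)

lemma add_in_completion:
  assumes "f \<in> completion S" "g \<in> completion S"
  shows "(\<lambda>n. f n + g n) \<in> completion S"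
  using assms by (auto simp: completion_def subspace_add subspace_piece)

lemma completion_mult_in_completion:
  assumes "f \<in> completion S" "g \<in> completion S"
  shows "completion_mult f g \<in> completion S"
proof -
  have "f i * g (n - i) \<in> S n" if "i \<in> {1..<n}" for i n
    using assms that mult_piece[of i "n - i" "f i" "g (n - i)"] by (auto simp: completion_def)
  then show ?thesis
    by (auto simp: completion_def completion_mult_def intro!: subspace_sum subspace_piece)
qed

text \<open>
  If \<open>(T x)\<^sub>n\<close> depends only on the entries \<open>x\<^sub>i\<close> with \<open>i < n\<close>, then \<open>x + T x = y\<close> reads
  \<open>x\<^sub>n = y\<^sub>n - (T x)\<^sub>n\<close>, which is a recursion on the degree: it determines \<open>x\<close> and produces a
  solution.
\<close>

lemma bij_betw_id_plus_strictly_causal: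
  assumes closed: "\<And>x. x \<in> completion S \<Longrightarrow> T x \<in> completion S"
    and causal: "\<And>x x' n. x \<in> completion S \<Longrightarrow> x' \<in> completion S \<Longrightarrow> (\<And>i. i < n \<Longrightarrow> x i = x' i)
      \<Longrightarrow> T x n = T x' n"
  shows "bij_betw (\<lambda>x n. x n + T x n) (completion S) (completion S)"
proof (rule bij_betw_imageI)
  show "inj_on (\<lambda>x n. x n + T x n) (completion S)"
  proof (rule inj_onI)
    fix x x'
    assume x: "x \<in> completion S" and x': "x' \<in> completion S"
      and eq: "(\<lambda>n. x n + T x n) = (\<lambda>n. x' n + T x' n)"
    have "x n = x' n" for n
    proof (induction n rule: less_induct)
      case (less n)
      then have "T x n = T x' n"
        using causal x x' by blast
      with fun_cong[OF eq, of n] show ?case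
        by simp
    qed
    then show "x = x'"
      by blast
  qed
  show "(\<lambda>x n. x n + T x n) ` completion S = completion S"
  proof (intro equalityI subsetI)
    fix y
    assume "y \<in> (\<lambda>x n. x n + T x n) ` completion S"
    then show "y \<in> completion S"
      using closed add_in_completion by auto
  next
    fix y
    assume y: "y \<in> completion S"
    define x where "x = triangular_solution T y"
    define trunc where "trunc n = (\<lambda>i. if i < n then x i else 0)" for n
    have x_eq: "x n = y n - T (trunc n) n" for n
      unfolding x_def trunc_def by (rule triangular_solution.simps)
    \<comment> \<open>The truncations have to lie in the completion before \<open>closed\<close> and \<open>causal\<close> apply to
      them, so membership is proved along the truncations first.\<close>
    have trunc: "trunc n \<in> completion S" for n
    proof (induction n)
      case 0
      show ?case
        using zero_in_completion by (simp add: trunc_def)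
    next
      case (Suc n)
      have Tn: "T (trunc n) \<in> completion S"
        using Suc closed by blast
      have xn: "x n \<in> S n" if "n \<ge> 1"
        using y Tn that by (simp add: x_eq completion_def subspace_diff subspace_piece)
      have x0: "x n = 0" if "n = 0"
        using y Tn that by (simp add: x_eq completion_def)
      have "trunc (Suc n) = (trunc n)(n := x n)"
        by (auto simp: trunc_def fun_eq_iff less_Suc_eq)
      with Suc xn x0 show ?case
        by (auto simp: completion_def)
    qed
    have x: "x \<in> completion S"
    proof -
      have "x n = trunc (Suc n) n" for n
        by (simp add: trunc_def)
      with trunc show ?thesis
        by (auto simp: completion_def)
    qed
    have "T (trunc n) n = T x n" for n
      by (rule causal[OF trunc x]) (simp add: trunc_def)
    then have "y = (\<lambda>n. x n + T x n)"
      by (simp add: x_eq fun_eq_iff)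
    with x show "y \<in> (\<lambda>x n. x n + T x n) ` completion S"
      by blast
  qed
qed

section \<open>Powers of series with constant term one\<close>

lemma fst_adj_power: "fst (adj_power scale (1, g) k) = 1"
  by (induction k) (auto simp: adj_one_def adj_mult_def)

lemma snd_adj_power_Suc:
  "snd (adj_power scale (1, g) (Suc k)) =
    (\<lambda>n. snd (adj_power scale (1, g) k) n + g n
      + completion_mult g (snd (adj_power scale (1, g) k)) n)"
  by (simp add: adj_mult_def fst_adj_power)

lemma snd_adj_power_in_completion:
  assumes "g \<in> completion S"
  shows "snd (adj_power scale (1, g) k) \<in> completion S"
proof (induction k)
  case 0
  show ?case
    using zero_in_completion by (simp add: adj_one_def)
next
  case (Suc k)
  then show ?case
    unfolding snd_adj_power_Suc
    by (intro add_in_completion completion_mult_in_completion assms)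
qed

lemma snd_adj_power_causal:
  assumes "\<And>i. i \<le> n \<Longrightarrow> g i = g' i"
  shows "snd (adj_power scale (1, g) k) n = snd (adj_power scale (1, g') k) n"
  using assms
proof (induction k arbitrary: n)
  case 0
  show ?case
    by simp
next
  case (Suc k)
  have "completion_mult g (snd (adj_power scale (1, g) k)) n =
      completion_mult g' (snd (adj_power scale (1, g') k)) n"
    unfolding completion_mult_def by (intro sum.cong refl arg_cong2[where f = times] Suc) auto
  moreover have "snd (adj_power scale (1, g) k) n = snd (adj_power scale (1, g') k) n"
    using Suc by blast
  ultimately show ?case
    using Suc.prems unfolding snd_adj_power_Suc by simp
qed

lemma snd_adj_power_one: "snd (adj_power scale (1, \<lambda>_. 0) k) = (\<lambda>_. 0)"
  by (induction k) (auto simp: snd_adj_power_Suc completion_mult_def adj_one_def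
      simp del: adj_power.simps(2))

section \<open>The product in each degree\<close>

definition circ_remainder :: "(nat \<Rightarrow> 'a) \<Rightarrow> (nat \<Rightarrow> 'a) \<Rightarrow> nat \<Rightarrow> 'a" where
  "circ_remainder f g n = (\<Sum>m=1..<n. f m * snd (adj_power scale (1, g) (Suc m)) (n - m))"

lemma circ_summand_0:
  "adj_mult scale (adj_component (1, f) 0) (adj_power scale (1, g) (Suc 0)) = (1, g)"
  by (simp add: adj_mult_def adj_component_def adj_one_def completion_mult_def)

text \<open>
  For \<open>m > 0\<close> the constant term \<open>1\<close> of the power reproduces \<open>f m\<close> in degree \<open>m\<close>; its
  remaining terms have positive degree and move \<open>f m\<close> to degrees above \<open>m\<close>.
\<close>

lemma snd_circ_summand:
  assumes "m > 0"
  shows "snd (adj_mult scale (adj_component (1, f) m) (adj_power scale (1, g) (Suc m))) n =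
    (if n = m then f m
     else if m < n then f m * snd (adj_power scale (1, g) (Suc m)) (n - m) else 0)"
proof -
  let ?h = "snd (adj_power scale (1, g) (Suc m))"
  have "completion_mult (\<lambda>i. if i = m then f m else 0) ?h n =
      (\<Sum>i=1..<n. if i = m then f m * ?h (n - m) else 0)"
    unfolding completion_mult_def by (intro sum.cong) auto
  also have "\<dots> = (if m < n then f m * ?h (n - m) else 0)"
    using assms by (subst sum.delta) auto
  finally show ?thesis
    using assms by (simp add: adj_mult_def adj_component_def fst_adj_power
        cong: if_cong del: adj_power.simps)
qed

lemma circ_eq:
  assumes "f 0 = 0"
  shows "circ scale (1, f) (1, g) = (1, \<lambda>n. f n + g n + circ_remainder f g n)"
proof -
  define F where
    "F m = adj_mult scale (adj_component (1, f) m) (adj_power scale (1, g) (m + 1))" for m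
  have F0: "F 0 = (1, g)"
    using circ_summand_0 by (simp add: F_def)
  have fst_F: "fst (F m) = 0" if "m > 0" for m
    unfolding F_def using that by (rule circ_summand_eq_0)
  have "Sum_any (\<lambda>m. fst (F m)) = (\<Sum>m\<in>{0}. fst (F m))"
    using fst_F by (intro Sum_any.expand_superset) auto
  then have fst_sum: "Sum_any (\<lambda>m. fst (F m)) = 1"
    by (simp add: F0)
  have snd_sum: "Sum_any (\<lambda>m. snd (F m) n) = f n + g n + circ_remainder f g n" for n
  proof -
    have "snd (F m) n = 0" if "m > n" for m
      unfolding F_def using that by (rule circ_summand_eq_0)
    then have "{m. snd (F m) n \<noteq> 0} \<subseteq> {..n}"
      by (auto simp: not_less[symmetric])
    then have "Sum_any (\<lambda>m. snd (F m) n) = (\<Sum>m\<le>n. snd (F m) n)"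
      by (intro Sum_any.expand_superset) auto
    also have "\<dots> = f n + g n + circ_remainder f g n"
    proof (cases "n = 0")
      case True
      then show ?thesis
        by (simp add: F0 assms circ_remainder_def)
    next
      case False
      then have "{..n} = insert 0 (insert n {1..<n})"
        by auto
      with False have "(\<Sum>m\<le>n. snd (F m) n) =
          snd (F 0) n + (snd (F n) n + (\<Sum>m=1..<n. snd (F m) n))"
        by simp
      also have "snd (F n) n = f n"
        using False snd_circ_summand[of n f g n] by (simp add: F_def del: adj_power.simps)
      also have "(\<Sum>m=1..<n. snd (F m) n) = circ_remainder f g n"
        unfolding circ_remainder_def
        by (intro sum.cong refl) (simp add: F_def snd_circ_summand del: adj_power.simps)
      finally show ?thesis
        by (simp add: F0 ac_simps)
    qed
    finally show ?thesis .
  qed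
  show ?thesis
    unfolding circ_def adj_sum_def F_def[symmetric] by (simp add: fst_sum snd_sum)
qed

lemma circ_remainder_in_completion:
  assumes "f \<in> completion S" "g \<in> completion S"
  shows "circ_remainder f g \<in> completion S"
proof -
  have "f m * snd (adj_power scale (1, g) (Suc m)) (n - m) \<in> S n" if "m \<in> {1..<n}" for m n
    using assms(1) snd_adj_power_in_completion[OF assms(2), of "Suc m"] that
      mult_piece[of m "n - m" "f m" "snd (adj_power scale (1, g) (Suc m)) (n - m)"]
    by (auto simp: completion_def simp del: adj_power.simps)
  then show ?thesis
    by (auto simp: completion_def circ_remainder_def simp del: adj_power.simps
        intro!: subspace_sum subspace_piece)
qed

text \<open>
  In the sum for degree \<open>n\<close> both indices \<open>m\<close> and \<open>n - m\<close> are smaller than \<open>n\<close>, because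
  \<open>0 < m < n\<close>.
\<close>

lemma circ_remainder_strictly_causal:
  assumes "\<And>i. i < n \<Longrightarrow> f i = f' i" and "\<And>i. i < n \<Longrightarrow> g i = g' i"
  shows "circ_remainder f g n = circ_remainder f' g' n"
  unfolding circ_remainder_def
  by (intro sum.cong refl arg_cong2[where f = times] snd_adj_power_causal assms) auto

section \<open>The loop axioms\<close>

lemma bij_betw_Jg:
  fixes \<phi> :: "('k, 'a) adjoined \<Rightarrow> ('k, 'a) adjoined"
  assumes \<phi>: "\<And>x. x \<in> completion S \<Longrightarrow> \<phi> (1, x) = (1, \<lambda>n. x n + T x n)"
    and closed: "\<And>x. x \<in> completion S \<Longrightarrow> T x \<in> completion S"
    and causal: "\<And>x x' n. (\<And>i. i < n \<Longrightarrow> x i = x' i) \<Longrightarrow> T x n = T x' n"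
  shows "bij_betw \<phi> (Jg S) (Jg S)"
proof -
  have "bij_betw (map_prod id (\<lambda>x n. x n + T x n)) (Jg S) (Jg S)"
    unfolding Jg_def
    by (intro bij_betw_map_prod bij_betw_id bij_betw_id_plus_strictly_causal closed causal)
  moreover have "\<phi> p = map_prod id (\<lambda>x n. x n + T x n) p" if "p \<in> Jg S" for p
    using that \<phi> by (auto simp: Jg_def)
  ultimately show ?thesis
    using bij_betw_cong by blast
qed

lemma bij_betw_circ_left_translation:
  assumes f: "f \<in> completion S"
  shows "bij_betw (\<lambda>y. circ scale (1, f) y) (Jg S) (Jg S)"
proof (rule bij_betw_Jg)
  show "circ scale (1, f) (1, g) = (1, \<lambda>n. g n + (f n + circ_remainder f g n))" for g
    using f by (simp add: circ_eq completion_def fun_eq_iff ac_simps)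
  show "(\<lambda>n. f n + circ_remainder f g n) \<in> completion S" if "g \<in> completion S" for g
    using f that by (intro add_in_completion circ_remainder_in_completion)
  show "f n + circ_remainder f g n = f n + circ_remainder f g' n"
    if "\<And>i. i < n \<Longrightarrow> g i = g' i" for g g' n
    using that circ_remainder_strictly_causal[of n f f g g'] by simp
qed

lemma bij_betw_circ_right_translation:
  assumes g: "g \<in> completion S"
  shows "bij_betw (\<lambda>x. circ scale x (1, g)) (Jg S) (Jg S)"
proof (rule bij_betw_Jg)
  show "circ scale (1, f) (1, g) = (1, \<lambda>n. f n + (g n + circ_remainder f g n))"
    if "f \<in> completion S" for f
    using that by (simp add: circ_eq completion_def fun_eq_iff ac_simps)
  show "(\<lambda>n. g n + circ_remainder f g n) \<in> completion S" if "f \<in> completion S" for f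
    using g that by (intro add_in_completion circ_remainder_in_completion)
  show "g n + circ_remainder f g n = g n + circ_remainder f' g n"
    if "\<And>i. i < n \<Longrightarrow> f i = f' i" for f f' n
    using that circ_remainder_strictly_causal[of n f f' g g] by simp
qed

lemma circ_adj_one_left:
  assumes "y \<in> Jg S"
  shows "circ scale adj_one y = y"
  using assms by (auto simp: Jg_def adj_one_def circ_eq circ_remainder_def)

lemma circ_adj_one_right:
  assumes "x \<in> Jg S"
  shows "circ scale x adj_one = x"
  using assms
  by (auto simp: Jg_def completion_def adj_one_def circ_eq circ_remainder_def snd_adj_power_one
      simp del: adj_power.simps)

end

theorem proposition2p1:
  fixes scale :: "'k::field_char_0 \<Rightarrow> 'a::ring \<Rightarrow> 'a"
    and S :: "nat \<Rightarrow> 'a set"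
  assumes "graded_algebra scale S"
  shows "is_loop (Jg S) (circ scale) adj_one"
proof -
  interpret graded_algebra scale S
    by (rule assms)
  have bij: "bij_betw (\<lambda>y. circ scale x y) (Jg S) (Jg S)"
    "bij_betw (\<lambda>y. circ scale y x) (Jg S) (Jg S)" if "x \<in> Jg S" for x
    using that bij_betw_circ_left_translation bij_betw_circ_right_translation
    by (auto simp: Jg_def)
  have "circ scale x y \<in> Jg S" if "x \<in> Jg S" "y \<in> Jg S" for x y
    using bij(1)[OF that(1)] that(2) by (rule bij_betw_apply)
  moreover have "adj_one \<in> Jg S"
    by (simp add: adj_one_def Jg_def zero_in_completion)
  ultimately show ?thesis
    unfolding is_loop_def using bij circ_adj_one_left circ_adj_one_right by blast
qed

end
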